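(* Let $\tau$ be an isosceles spherical trapezoid with bases of lengths $x$ and $z$ and lateral sides of length $y$. Let $A$ be the (equal) angles at the base $x$ and $C$ be the (equal) angles at the base $z$. Then \begin{align*} \cos A&=\frac{\cos y\,\sin\frac{x}{2}-\sin\frac{z}{2}}{\sin y\,\cos\frac{x}{2}},\\ \cos C&=\frac{\cos y\,\sin\frac{z}{2}-\sin\frac{x}{2}}{\sin y\,\cos\frac{z}{2}}. \end{align*}
   Context: An isosceles spherical trapezoid is a (convex) spherical quadrilateral on the unit sphere $\mathbb{S}^2$, with sides being arcs of great circles, that admits a mirror symmetry about the line (great circle) passing through the midpoints of a pair of its opposite sides. These two opposite sides are called the bases; the other two sides, which are exchanged by the symmetry and hence have equal length, are the lateral sides. Angles are interior angles. *)

theory Defs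
  imports "HOL-Analysis.Analysis"
begin

unbundle cross3_syntax

text \<open>
  The unit sphere is \<^term>\<open>sphere (0 :: real^3) 1\<close>. The notions below that refer to the side
  joining two points are meant for points that are neither equal nor antipodal, so that the side is
  the shorter arc of the unique great circle through them. Sides of a convex quadrilateral always
  have this property, because the cross product in its definition cannot vanish.
\<close>

definition spherical_dist :: "real^3 \<Rightarrow> real^3 \<Rightarrow> real" where
  "spherical_dist P Q = arccos (P \<bullet> Q)"

text \<open>The arc is the radial projection of the chord.\<close>

definition spherical_arc :: "real^3 \<Rightarrow> real^3 \<Rightarrow> (real^3) set" where
  "spherical_arc P Q = sgn ` closed_segment P Q"

definition arc_midpoint :: "real^3 \<Rightarrow> real^3 \<Rightarrow> real^3" where
  "arc_midpoint P Q = sgn (midpoint P Q)"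

definition great_circle :: "real^3 \<Rightarrow> (real^3) set" where
  "great_circle n = {v \<in> sphere 0 1. n \<bullet> v = 0}"

text \<open>For a unit vector \<open>n\<close>, the mirror symmetry about the great circle with normal \<open>n\<close>.\<close>

definition reflection_across :: "real^3 \<Rightarrow> real^3 \<Rightarrow> real^3" where
  "reflection_across n v = v - (2 * (n \<bullet> v)) *\<^sub>R n"

text \<open>
  The component of \<open>Q\<close> orthogonal to \<open>P\<close> is the direction at \<open>P\<close> of the arc from \<open>P\<close> to \<open>Q\<close>.
\<close>

definition tangent_towards :: "real^3 \<Rightarrow> real^3 \<Rightarrow> real^3" where
  "tangent_towards P Q = Q - (P \<bullet> Q) *\<^sub>R P"

text \<open>
  The angle at the middle argument \<open>P\<close> between the arcs to \<open>Q\<close> and \<open>R\<close>, with values in \<open>[0, pi]\<close>.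
  It is the interior angle of a convex polygon having these arcs as adjacent sides.
\<close>

definition spherical_angle :: "real^3 \<Rightarrow> real^3 \<Rightarrow> real^3 \<Rightarrow> real" where
  "spherical_angle Q P R =
     (let u = tangent_towards P Q; v = tangent_towards P R
      in arccos ((u \<bullet> v) / (norm u * norm v)))"

text \<open>
  \<open>R\<close> and \<open>S\<close> lie in the same open hemisphere bounded by the great circle through \<open>P\<close> and \<open>Q\<close>,
  whose normal is the cross product.
\<close>

definition strictly_same_side :: "real^3 \<Rightarrow> real^3 \<Rightarrow> real^3 \<Rightarrow> real^3 \<Rightarrow> bool" where
  "strictly_same_side P Q R S \<longleftrightarrow> (((P \<times> Q) \<bullet> R) * ((P \<times> Q) \<bullet> S) > 0)"

text \<open>
  Vertices are listed in cyclic order, in either orientation. Convexity: the quadrilateral lies on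
  one side of the great circle through each of its sides (strictly, so that no angle equals \<open>pi\<close>).
\<close>

definition convex_spherical_quadrilateral ::
    "real^3 \<Rightarrow> real^3 \<Rightarrow> real^3 \<Rightarrow> real^3 \<Rightarrow> bool" where
  "convex_spherical_quadrilateral P Q R S \<longleftrightarrow>
     {P, Q, R, S} \<subseteq> sphere 0 1 \<and>
     strictly_same_side P Q R S \<and>
     strictly_same_side Q R S P \<and>
     strictly_same_side R S P Q \<and>
     strictly_same_side S P Q R"

definition quadrilateral_sides ::
    "real^3 \<Rightarrow> real^3 \<Rightarrow> real^3 \<Rightarrow> real^3 \<Rightarrow> (real^3) set set" where
  "quadrilateral_sides P Q R S =
     {spherical_arc P Q, spherical_arc Q R, spherical_arc R S, spherical_arc S P}"

definition quadrilateral_symmetry ::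
    "(real^3 \<Rightarrow> real^3) \<Rightarrow> real^3 \<Rightarrow> real^3 \<Rightarrow> real^3 \<Rightarrow> real^3 \<Rightarrow> bool" where
  "quadrilateral_symmetry f P Q R S \<longleftrightarrow>
     f ` {P, Q, R, S} = {P, Q, R, S} \<and>
     (\<lambda>s. f ` s) ` quadrilateral_sides P Q R S = quadrilateral_sides P Q R S"

text \<open>The bases are \<open>PQ\<close> and \<open>RS\<close>; the lateral sides are \<open>QR\<close> and \<open>SP\<close>.\<close>

definition isosceles_spherical_trapezoid ::
    "real^3 \<Rightarrow> real^3 \<Rightarrow> real^3 \<Rightarrow> real^3 \<Rightarrow> bool" where
  "isosceles_spherical_trapezoid P Q R S \<longleftrightarrow>
     convex_spherical_quadrilateral P Q R S \<and>
     (\<exists>n. norm n = 1 \<and>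
        arc_midpoint P Q \<in> great_circle n \<and>
        arc_midpoint R S \<in> great_circle n \<and>
        quadrilateral_symmetry (reflection_across n) P Q R S)"

end

theory Submission
  imports Defs
begin

text \<open>
  Let \<open>n\<close> be the unit normal of the mirror, \<open>a = n \<bullet> P\<close> and \<open>b = n \<bullet> R\<close>. The symmetry exchanges
  \<open>P\<close> with \<open>Q\<close> and \<open>R\<close> with \<open>S\<close>, so \<open>Q = P - 2 a n\<close> and \<open>S = R - 2 b n\<close>. Hence
  \<open>cos x = P \<bullet> Q = 1 - 2 a\<^sup>2\<close>, which says that half of the base \<open>x\<close> has sine \<open>\<bar>a\<bar>\<close>; likewise half of
  the base \<open>z\<close> has sine \<open>\<bar>b\<bar>\<close>. The lateral side has cosine \<open>S \<bullet> P\<close> and the diagonal has cosine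
  \<open>S \<bullet> Q = S \<bullet> P + 2 a b\<close>. Convexity forces \<open>P\<close> and \<open>S\<close> onto the same side of the mirror, i.e.
  \<open>a b < 0\<close>, so the diagonal has cosine \<open>cos y - 2 sin (x/2) sin (z/2)\<close>. The spherical law of cosines
  in the triangle \<open>S P Q\<close> then gives
  \<open>cos A = (cos y - 2 sin (x/2) sin (z/2) - cos y cos x) / (sin y sin x)\<close>, and the double-angle
  formulas for \<open>x = 2 (x/2)\<close> make it possible to cancel
  \<open>2 sin (x/2)\<close>. The formula for \<open>C\<close> is the same statement for the quadrilateral read from its
  other base.

  The less obvious part is that the symmetry has to act in this way, since it is only assumed to
  permute the vertices and the sides and to fix the two midpoints (lemma \<open>trapezoid_mirror\<close>). The
  midpoints give \<open>n \<bullet> Q = - a\<close> and \<open>n \<bullet> S = - b\<close>. The vertices cannot lie on the mirror, and if the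
  mirror image of \<open>P\<close> were \<open>R\<close> or \<open>S\<close>, then \<open>P + Q = R + S\<close>, so that \<open>P Q\<close> and \<open>R S\<close> would be
  crossing diagonals instead of sides.
\<close>

section \<open>Spherical triangles\<close>

lemma inner_tangent_towards:
  assumes "norm P = 1"
  shows "tangent_towards P Q \<bullet> tangent_towards P R = Q \<bullet> R - (P \<bullet> Q) * (P \<bullet> R)"
  using assms
  by (simp add: tangent_towards_def inner_commute dot_square_norm algebra_simps)

lemma norm_tangent_towards:
  assumes "norm P = 1" "norm Q = 1"
  shows "norm (tangent_towards P Q) = sqrt (1 - (P \<bullet> Q)\<^sup>2)"
  unfolding norm_eq_sqrt_inner[of "tangent_towards P Q"] inner_tangent_towards[OF assms(1)]
  using assms by (simp add: dot_square_norm power2_eq_square)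

text \<open>
  An angle depends on the vertices only through their inner products; in particular, it is
  preserved by isometries.
\<close>

lemma spherical_angle_eq_arccos:
  assumes "norm P = 1" "norm Q = 1" "norm R = 1"
  shows "spherical_angle Q P R =
    arccos ((Q \<bullet> R - (P \<bullet> Q) * (P \<bullet> R)) / (sqrt (1 - (P \<bullet> Q)\<^sup>2) * sqrt (1 - (P \<bullet> R)\<^sup>2)))"
  using assms
  by (simp add: spherical_angle_def Let_def inner_tangent_towards norm_tangent_towards)

lemma spherical_angle_commute: "spherical_angle Q P R = spherical_angle R P Q"
  unfolding spherical_angle_def Let_def
  by (metis inner_commute mult.commute)

lemma abs_inner_unit_le_1:
  fixes P Q :: "real^3"
  assumes "norm P = 1" "norm Q = 1"
  shows "\<bar>P \<bullet> Q\<bar> \<le> 1"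
  using Cauchy_Schwarz_ineq2[of P Q] assms by simp

lemma cos_spherical_dist:
  assumes "norm P = 1" "norm Q = 1"
  shows "cos (spherical_dist P Q) = P \<bullet> Q"
  using abs_inner_unit_le_1[OF assms] by (simp add: spherical_dist_def cos_arccos_abs)

lemma sin_spherical_dist:
  assumes "norm P = 1" "norm Q = 1"
  shows "sin (spherical_dist P Q) = sqrt (1 - (P \<bullet> Q)\<^sup>2)"
  using abs_inner_unit_le_1[OF assms] by (simp add: spherical_dist_def sin_arccos_abs)

theorem spherical_law_of_cosines:
  assumes "norm P = 1" "norm Q = 1" "norm R = 1"
  shows "cos (spherical_angle Q P R) =
    (cos (spherical_dist Q R) - cos (spherical_dist P Q) * cos (spherical_dist P R)) /
    (sin (spherical_dist P Q) * sin (spherical_dist P R))"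
proof -
  let ?u = "tangent_towards P Q" and ?v = "tangent_towards P R"
  have "\<bar>?u \<bullet> ?v\<bar> / (norm ?u * norm ?v) \<le> 1"
    by (rule order.trans[OF divide_right_mono[OF Cauchy_Schwarz_ineq2]]) auto
  then have "\<bar>(?u \<bullet> ?v) / (norm ?u * norm ?v)\<bar> \<le> 1"
    by (simp add: abs_mult)
  then have "cos (spherical_angle Q P R) = (?u \<bullet> ?v) / (norm ?u * norm ?v)"
    by (simp add: spherical_angle_def Let_def cos_arccos_abs)
  then show ?thesis
    using assms
    by (simp add: inner_tangent_towards norm_tangent_towards cos_spherical_dist sin_spherical_dist)
qed

section \<open>The mirror of an isosceles trapezoid\<close>

lemma inner_reflection_across:
  "w \<bullet> reflection_across n v = w \<bullet> v - 2 * (n \<bullet> v) * (n \<bullet> w)"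
  by (simp add: reflection_across_def inner_diff_right inner_commute)

lemma inner_normal_reflection_across:
  assumes "norm n = 1"
  shows "n \<bullet> reflection_across n v = - (n \<bullet> v)"
  using assms by (simp add: inner_reflection_across dot_square_norm)

lemma inner_reflection_across_both:
  assumes "norm n = 1"
  shows "reflection_across n v \<bullet> reflection_across n w = v \<bullet> w"
proof -
  have "reflection_across n v \<bullet> reflection_across n w =
      w \<bullet> reflection_across n v - 2 * (n \<bullet> w) * (n \<bullet> reflection_across n v)"
    by (simp add: inner_reflection_across[of "reflection_across n v"] inner_commute)
  also have "\<dots> = v \<bullet> w"
    unfolding inner_normal_reflection_across[OF assms]
    by (simp add: inner_reflection_across inner_commute)
  finally show ?thesis .
qed

lemma reflection_across_involution:
  assumes "norm n = 1"
  shows "reflection_across n (reflection_across n v) = v"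
  using inner_normal_reflection_across[OF assms, of v]
  by (simp add: reflection_across_def)

lemma arc_midpoint_on_great_circle:
  assumes "arc_midpoint P Q \<in> great_circle n"
  shows "n \<bullet> Q = - (n \<bullet> P)"
proof -
  have "sgn (midpoint P Q) \<noteq> 0" "n \<bullet> sgn (midpoint P Q) = 0"
    using assms by (auto simp: arc_midpoint_def great_circle_def)
  then have "n \<bullet> midpoint P Q = 0"
    by (auto simp: sgn_div_norm)
  then show ?thesis
    by (simp add: midpoint_def inner_add_right)
qed

text \<open>
  A mirror that exchanges the ends of both bases makes \<open>P \<times> Q\<close> and \<open>R \<times> S\<close> explicit. For this
  reason, the triple products in the condition for the lateral side \<open>S P\<close> are permuted cyclically
  here.
\<close>

lemma convex_spherical_quadrilateral_triple_products:
  assumes "convex_spherical_quadrilateral P Q R S"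
  shows "((P \<times> Q) \<bullet> R) * ((P \<times> Q) \<bullet> S) > 0" "((R \<times> S) \<bullet> P) * ((R \<times> S) \<bullet> Q) > 0"
    "((P \<times> Q) \<bullet> S) * ((R \<times> S) \<bullet> P) > 0"
proof -
  have "(S \<times> P) \<bullet> Q = (P \<times> Q) \<bullet> S" "(S \<times> P) \<bullet> R = (R \<times> S) \<bullet> P"
    by (simp_all add: cross3_simps)
  with assms show "((P \<times> Q) \<bullet> R) * ((P \<times> Q) \<bullet> S) > 0" "((R \<times> S) \<bullet> P) * ((R \<times> S) \<bullet> Q) > 0"
    "((P \<times> Q) \<bullet> S) * ((R \<times> S) \<bullet> P) > 0"
    by (auto simp: convex_spherical_quadrilateral_def strictly_same_side_def)
qed

text \<open>
  If the mirror contained the side \<open>P Q\<close>, it would separate \<open>R\<close> from \<open>S\<close>, or contain both.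
\<close>

lemma mirror_avoids_side:
  assumes same_side: "((P \<times> Q) \<bullet> R) * ((P \<times> Q) \<bullet> S) > 0"
    and n: "norm n = 1" "n \<bullet> P = 0" "n \<bullet> Q = 0"
    and opposite: "n \<bullet> S = - (n \<bullet> R)"
  shows False
proof -
  have "n \<times> (P \<times> Q) = 0"
    using n by (simp add: Lagrange)
  then have "collinear {0, n, P \<times> Q}"
    by (simp add: cross_eq_0)
  moreover have "n \<noteq> 0" using n by auto
  ultimately obtain c where c: "P \<times> Q = c *\<^sub>R n"
    by (auto simp: collinear_lemma)
  have "(c * (n \<bullet> R)) * (c * (n \<bullet> S)) > 0"
    using same_side by (simp add: c)
  then show False
    unfolding opposite by (simp add: zero_less_mult_iff)
qed

text \<open>
  The strict inequality places \<open>P\<close> and \<open>S\<close> on the same side of the mirror, so that the lateral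
  side \<open>S P\<close> does not cross it; the opposite sign would describe a quadrilateral whose lateral
  sides intersect.
\<close>

lemma trapezoid_mirror:
  assumes "isosceles_spherical_trapezoid P Q R S"
  obtains n where "norm n = 1" "Q = reflection_across n P" "S = reflection_across n R"
    "n \<bullet> P \<noteq> 0" "(n \<bullet> P) * (n \<bullet> R) < 0"
proof -
  from assms obtain n where convex: "convex_spherical_quadrilateral P Q R S"
    and n: "norm n = 1"
    and mid: "arc_midpoint P Q \<in> great_circle n" "arc_midpoint R S \<in> great_circle n"
    and perm: "reflection_across n ` {P, Q, R, S} = {P, Q, R, S}"
    unfolding isosceles_spherical_trapezoid_def quadrilateral_symmetry_def by blast
  note convex = convex_spherical_quadrilateral_triple_products[OF convex]
  have nQ: "n \<bullet> Q = - (n \<bullet> P)" and nS: "n \<bullet> S = - (n \<bullet> R)"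
    using mid by (simp_all add: arc_midpoint_on_great_circle)
  have nP: "n \<bullet> P \<noteq> 0"
    using mirror_avoids_side[OF convex(1) n] nQ nS by auto
  have nR: "n \<bullet> R \<noteq> 0"
    using mirror_avoids_side[OF convex(2) n] nQ nS by auto
  let ?s = "reflection_across n"
  have distinct: "P \<noteq> Q" "P \<noteq> R" "Q \<noteq> R"
    using convex(1) by (auto simp: dot_cross_self)
  have fixfree: "?s v \<noteq> v" if "n \<bullet> v \<noteq> 0" for v
    using inner_normal_reflection_across[OF n, of v] that by auto
  have invol: "?s (?s v) = v" for v
    by (rule reflection_across_involution[OF n])
  have "P + Q \<noteq> R + S"
  proof
    assume "P + Q = R + S"
    then have "(P \<times> Q) \<bullet> (R + S) = 0"
      by (simp add: inner_add_right dot_cross_self flip: \<open>P + Q = R + S\<close>)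
    then have "(P \<times> Q) \<bullet> S = - ((P \<times> Q) \<bullet> R)"
      by (simp add: inner_add_right)
    with convex(1) show False
      by (simp add: zero_less_mult_iff)
  qed
  have "?s P \<in> {P, Q, R, S}" "?s Q \<in> {P, Q, R, S}" "?s R \<in> {P, Q, R, S}"
    using perm by blast+
  then have move: "?s P \<in> {Q, R, S}" "?s Q \<in> {P, R, S}" "?s R \<in> {P, Q, S}"
    using fixfree[OF nP] fixfree[of Q] fixfree[OF nR] nP nQ by simp_all
  have P_to_Q: "?s P = Q"
  proof (rule ccontr)
    assume other: "?s P \<noteq> Q"
    then have "?s Q \<noteq> P"
      using invol[of Q] by metis
    moreover have "?s P \<noteq> ?s Q"
      using invol[of P] invol[of Q] distinct(1) by metis
    ultimately have "?s P + ?s Q = R + S"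
      using move(1,2) other by (auto simp: add.commute)
    \<comment> \<open>The displacements of \<open>P\<close> and \<open>Q\<close> under the reflection cancel.\<close>
    moreover have "?s P + ?s Q = P + Q"
      by (simp add: reflection_across_def nQ)
    ultimately show False
      using \<open>P + Q \<noteq> R + S\<close> by simp
  qed
  then have "?s Q = P"
    using invol[of P] by simp
  then have "?s R \<noteq> P" "?s R \<noteq> Q"
    using P_to_Q invol[of R] distinct by metis+
  then have "?s R = S"
    using move(3) by simp
  note swap = P_to_Q this
  \<comment> \<open>Both triple products in the condition for \<open>S P\<close> are multiples of \<open>(P \<times> n) \<bullet> R\<close>, so the
    condition determines the sign of the product of the remaining factors.\<close>
  have "P \<times> Q = (- 2 * (n \<bullet> P)) *\<^sub>R (P \<times> n)"
    unfolding swap[symmetric] reflection_across_def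
    by (simp add: Cross3.right_diff_distrib cross_mult_right)
  then have D: "(P \<times> Q) \<bullet> S = - 2 * (n \<bullet> P) * ((P \<times> n) \<bullet> R)"
    unfolding swap[symmetric] reflection_across_def
    by (simp add: inner_diff_right dot_cross_self)
  have "R \<times> S = (- 2 * (n \<bullet> R)) *\<^sub>R (R \<times> n)"
    unfolding swap[symmetric] reflection_across_def
    by (simp add: Cross3.right_diff_distrib cross_mult_right)
  moreover have "(R \<times> n) \<bullet> P = - ((P \<times> n) \<bullet> R)"
    by (simp add: cross3_simps)
  ultimately have D': "(R \<times> S) \<bullet> P = 2 * (n \<bullet> R) * ((P \<times> n) \<bullet> R)"
    by simp
  have "- 4 * ((n \<bullet> P) * (n \<bullet> R)) * ((P \<times> n) \<bullet> R)\<^sup>2 > 0"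
    using convex(3) unfolding D D' by (simp add: power2_eq_square mult_ac)
  then have "(n \<bullet> P) * (n \<bullet> R) < 0"
    by (smt (verit) mult_nonneg_nonneg zero_le_power2 mult_minus_left)
  with that n swap nP show thesis by metis
qed

section \<open>The angle at a base\<close>

lemma isosceles_spherical_trapezoid_rotate:
  assumes "isosceles_spherical_trapezoid P Q R S"
  shows "isosceles_spherical_trapezoid R S P Q"
proof -
  have "{R, S, P, Q} = {P, Q, R, S}" "quadrilateral_sides R S P Q = quadrilateral_sides P Q R S"
    by (auto simp: quadrilateral_sides_def)
  with assms show ?thesis
    unfolding isosceles_spherical_trapezoid_def convex_spherical_quadrilateral_def
      quadrilateral_symmetry_def by auto
qed

lemma isosceles_spherical_trapezoid_unit:
  assumes "isosceles_spherical_trapezoid P Q R S"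
  shows "norm P = 1" "norm Q = 1" "norm R = 1" "norm S = 1"
  using assms
  by (simp_all add: isosceles_spherical_trapezoid_def convex_spherical_quadrilateral_def)

text \<open>
  Half of the arc from \<open>P\<close> to its mirror image is the distance from \<open>P\<close> to the mirror.
\<close>

lemma sin_half_dist_reflection:
  assumes "norm n = 1" "norm P = 1" "norm (reflection_across n P) = 1"
  shows "sin (spherical_dist P (reflection_across n P) / 2) = \<bar>n \<bullet> P\<bar>"
proof -
  let ?x = "spherical_dist P (reflection_across n P)"
  have "cos ?x = 1 - 2 * (n \<bullet> P)\<^sup>2"
    using assms
    by (simp add: cos_spherical_dist inner_reflection_across dot_square_norm power2_eq_square)
  then have "(sin (?x / 2))\<^sup>2 = (n \<bullet> P)\<^sup>2"
    using cos_double_sin[of "?x / 2"] by simp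
  moreover have "0 \<le> ?x" "?x \<le> pi"
    using abs_inner_unit_le_1[OF assms(2,3)]
    by (auto simp: spherical_dist_def intro!: arccos_lbound arccos_ubound)
  then have "0 \<le> sin (?x / 2)"
    by (intro sin_ge_zero) auto
  ultimately show ?thesis
    by (metis abs_of_nonneg power2_eq_iff abs_minus_cancel)
qed

text \<open>The mirror exchanges the lateral sides, and it exchanges the diagonals.\<close>

lemma trapezoid_mirror_inner_eq:
  assumes "isosceles_spherical_trapezoid P Q R S"
  shows "S \<bullet> P = Q \<bullet> R" "S \<bullet> Q = R \<bullet> P"
proof -
  obtain n where n: "norm n = 1" "Q = reflection_across n P" "S = reflection_across n R"
    using trapezoid_mirror[OF assms] by metis
  have "P = reflection_across n Q"
    using n by (simp add: reflection_across_involution)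
  then show "S \<bullet> P = Q \<bullet> R"
    using n(1,3) by (metis inner_reflection_across_both inner_commute)
  show "S \<bullet> Q = R \<bullet> P"
    using n by (simp add: inner_reflection_across_both)
qed

lemma trapezoid_base_angles_eq:
  assumes "isosceles_spherical_trapezoid P Q R S"
  shows "spherical_angle P Q R = spherical_angle S P Q"
proof -
  have "spherical_angle P Q R = spherical_angle Q P S"
    using isosceles_spherical_trapezoid_unit[OF assms] trapezoid_mirror_inner_eq[OF assms]
    by (simp add: spherical_angle_eq_arccos inner_commute)
  then show ?thesis
    by (simp only: spherical_angle_commute)
qed

lemma cos_trapezoid_base_angle:
  assumes "isosceles_spherical_trapezoid P Q R S"
  defines "x \<equiv> spherical_dist P Q" and "z \<equiv> spherical_dist R S" and "y \<equiv> spherical_dist S P"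
  shows "cos (spherical_angle S P Q) =
    (cos y * sin (x / 2) - sin (z / 2)) / (sin y * cos (x / 2))"
proof -
  note unit = isosceles_spherical_trapezoid_unit[OF assms(1)]
  obtain n where n: "norm n = 1" and Q: "Q = reflection_across n P" and S: "S = reflection_across n R"
    and nP: "n \<bullet> P \<noteq> 0" and opposite: "(n \<bullet> P) * (n \<bullet> R) < 0"
    using trapezoid_mirror[OF assms(1)] by metis
  have sin_x: "sin (x / 2) = \<bar>n \<bullet> P\<bar>" and sin_z: "sin (z / 2) = \<bar>n \<bullet> R\<bar>"
    unfolding x_def z_def Q S
    using sin_half_dist_reflection[OF n] unit by (simp_all add: Q S)
  have "cos (spherical_dist S Q) = S \<bullet> P - 2 * (n \<bullet> P) * (n \<bullet> S)"
    using unit by (simp add: cos_spherical_dist Q inner_reflection_across)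
  also have "\<dots> = cos y + 2 * ((n \<bullet> P) * (n \<bullet> R))"
    using unit by (simp add: y_def cos_spherical_dist S inner_normal_reflection_across[OF n])
  also have "(n \<bullet> P) * (n \<bullet> R) = - (sin (x / 2) * sin (z / 2))"
    using opposite by (simp add: sin_x sin_z flip: abs_mult)
  finally have diagonal: "cos (spherical_dist S Q) = cos y - 2 * sin (x / 2) * sin (z / 2)"
    by simp
  have "y = spherical_dist P S"
    by (simp add: y_def spherical_dist_def inner_commute)
  then have "cos (spherical_angle S P Q) =
      (cos y - 2 * sin (x / 2) * sin (z / 2) - cos y * cos x) / (sin y * sin x)"
    using spherical_law_of_cosines[of P S Q] unit diagonal by (simp add: x_def)
  also have "cos x = 1 - 2 * (sin (x / 2))\<^sup>2"
    using cos_double_sin[of "x / 2"] by simp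
  also have "sin x = 2 * sin (x / 2) * cos (x / 2)"
    using sin_double[of "x / 2"] by simp
  also have "(cos y - 2 * sin (x / 2) * sin (z / 2) - cos y * (1 - 2 * (sin (x / 2))\<^sup>2)) /
      (sin y * (2 * sin (x / 2) * cos (x / 2))) =
      ((2 * sin (x / 2)) * (cos y * sin (x / 2) - sin (z / 2))) /
      ((2 * sin (x / 2)) * (sin y * cos (x / 2)))"
    by (simp add: algebra_simps power2_eq_square)
  also have "\<dots> = (cos y * sin (x / 2) - sin (z / 2)) / (sin y * cos (x / 2))"
    using nP sin_x by (intro mult_divide_mult_cancel_left) simp
  finally show ?thesis .
qed

theorem theorem4:
  fixes P Q R S :: "real^3" and x y z A C :: real
  assumes trapezoid: "isosceles_spherical_trapezoid P Q R S"
    and base_x: "x = spherical_dist P Q"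
    and base_z: "z = spherical_dist R S"
    and lateral: "y = spherical_dist Q R"
    and angle_A: "A = spherical_angle S P Q"
    and angle_C: "C = spherical_angle Q R S"
  shows "spherical_dist S P = y \<and>
    spherical_angle P Q R = A \<and>
    spherical_angle R S P = C \<and>
    cos A = (cos y * sin (x / 2) - sin (z / 2)) / (sin y * cos (x / 2)) \<and>
    cos C = (cos y * sin (z / 2) - sin (x / 2)) / (sin y * cos (z / 2))"
proof -
  note rotated = isosceles_spherical_trapezoid_rotate[OF trapezoid]
  have "spherical_dist S P = y"
    using trapezoid_mirror_inner_eq[OF trapezoid] by (simp add: lateral spherical_dist_def)
  then show ?thesis
    using trapezoid_base_angles_eq[OF trapezoid] cos_trapezoid_base_angle[OF trapezoid]
      trapezoid_base_angles_eq[OF rotated] cos_trapezoid_base_angle[OF rotated]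
    by (simp add: base_x base_z lateral angle_A angle_C)
qed

end
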